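(* Let $S$ be a recursively axiomatized theory in the language of first order arithmetic which extends Peano arithmetic, and let $S_\Box$ be the formal system built from $S$ as described in the context. Suppose $S$ is sound, i.e., all axioms of $S$ are true in the standard model of arithmetic. If $A$ is a sentence of first order arithmetic (not involving $\Box$) which is false in the standard model, then $A$ is not a theorem of $S_\Box$, and for every $k\geq 1$ the sentence $\Box^k\ulcorner A\urcorner$ is not a theorem of $S_\Box$.
   Context: Conventions: all systems use intuitionistic first order logic; a classical theory such as PA is treated as an intuitionistic system whose non-logical axioms include every instance $A \vee \neg A$ for $A$ in its language. $\perp$ denotes the formula $0=1$, and $\neg A$ abbreviates $A \to \perp$. Formal proofs contain only sentences: all axioms are sentences (universal closures), generalization is expressed by the axioms $(\forall n_1,\ldots,n_k)(A\to B)\to(\forall n_2,\ldots,n_k)(A\to(\forall n_1)B)$ (when $n_1$ is not free in $A$) and $(\forall n_1,\ldots,n_k)(A\to B)\to(\forall n_2,\ldots,n_k)((\exists n_1)A\to B)$ (when $n_1$ is not free in $B$), and the only deduction rule is universally quantified modus ponens: from $(\forall n_1,\ldots,n_k)A$ and $(\forall n_1,\ldots,n_k)(A\to B)$ infer $(\forall n_1,\ldots,n_k)B$. The system $S_\Box$: its language is the language of first order arithmetic enriched by one unary relation symbol $\Box$ (read "is assertible"), with a fixed Gödel numbering; $\ulcorner A\urcorner$ is the Gödel number of $A$ and $\bar n$ is the $n$th numeral. The main axioms of $S_\Box$ are the universal closures of: (i) the non-logical axioms of $S$; (ii) all instances of the induction scheme and of the logical axiom schemes for formulas of the language of $S_\Box$;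 (iii) for all formulas $A,B$ of the language of $S_\Box$ (with the evident arithmetization of substitution of numerals): (1) $\Box\ulcorner A\vee B\urcorner\leftrightarrow \Box\ulcorner A\urcorner\vee\Box\ulcorner B\urcorner$; (2) $\Box\ulcorner A\wedge B\urcorner\leftrightarrow\Box\ulcorner A\urcorner\wedge\Box\ulcorner B\urcorner$; (3) $(\exists n)\Box\ulcorner A(\bar n)\urcorner\to\Box\ulcorner(\exists n)A(n)\urcorner$; (4) $\Box\ulcorner(\forall n)A(n)\urcorner\leftrightarrow(\forall n)\Box\ulcorner A(\bar n)\urcorner$; (5) $\Box\ulcorner A\to B\urcorner\to(\Box\ulcorner A\urcorner\to\Box\ulcorner B\urcorner)$; (6) (capture) $A(n_1,\ldots,n_k)\to\Box\ulcorner A(\bar n_1,\ldots,\bar n_k)\urcorner$ for every formula $A$ with free variables $n_1,\ldots,n_k$. Let ${\rm Ax}(g)$ be an arithmetical formula expressing that $g$ is the Gödel number of a main axiom, chosen so that whenever ${\rm Ax}(\bar g)$ holds it is provable in PA. In addition to the main axioms, $S_\Box$ has one jump axiom $(\forall g)({\rm Ax}(g)\to\Box(g))$. Notation: $\Box^1\ulcorner A\urcorner$ is $\Box\ulcorner A\urcorner$, and $\Box^{k+1}\ulcorner A\urcorner$ is $\Box\ulcorner\Box^k\ulcorner A\urcorner\urcorner$ (i.e., $k$ nested applications of $\Box$ to Gödel numbers). *)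

theory Defs
  imports Main
begin

section \<open>Language\<close>

datatype tm = Zero | Var nat | Succ tm | Plus tm tm | Times tm tm

datatype fm =
    Eq tm tm (infix "\<^bold>=" 58)
  | Box tm
  | Conj fm fm (infixr "\<^bold>\<and>" 57)
  | Disj fm fm (infixr "\<^bold>\<or>" 56)
  | Imp fm fm (infixr "\<^bold>\<longrightarrow>" 55)
  | Forall nat fm
  | Exists nat fm

abbreviation Falsum :: fm where "Falsum \<equiv> Zero \<^bold>= Succ Zero"
abbreviation Neg :: "fm \<Rightarrow> fm" where "Neg A \<equiv> A \<^bold>\<longrightarrow> Falsum"
abbreviation Iff :: "fm \<Rightarrow> fm \<Rightarrow> fm" (infix "\<^bold>\<longleftrightarrow>" 54)
  where "A \<^bold>\<longleftrightarrow> B \<equiv> (A \<^bold>\<longrightarrow> B) \<^bold>\<and> (B \<^bold>\<longrightarrow> A)"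

primrec foralls :: "nat list \<Rightarrow> fm \<Rightarrow> fm" where
  "foralls [] A = A"
| "foralls (n # ns) A = Forall n (foralls ns A)"

primrec num :: "nat \<Rightarrow> tm" where
  "num 0 = Zero"
| "num (Suc n) = Succ (num n)"

primrec fvt :: "tm \<Rightarrow> nat set" where
  "fvt Zero = {}"
| "fvt (Var v) = {v}"
| "fvt (Succ t) = fvt t"
| "fvt (Plus s t) = fvt s \<union> fvt t"
| "fvt (Times s t) = fvt s \<union> fvt t"

primrec fv :: "fm \<Rightarrow> nat set" where
  "fv (s \<^bold>= t) = fvt s \<union> fvt t"
| "fv (Box t) = fvt t"
| "fv (A \<^bold>\<and> B) = fv A \<union> fv B"
| "fv (A \<^bold>\<or> B) = fv A \<union> fv B"
| "fv (A \<^bold>\<longrightarrow> B) = fv A \<union> fv B"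
| "fv (Forall x A) = fv A - {x}"
| "fv (Exists x A) = fv A - {x}"

definition sentence :: "fm \<Rightarrow> bool" where "sentence A \<longleftrightarrow> fv A = {}"

text \<open>Formulas of first order arithmetic, i.e. those in which \<open>Box\<close> does not occur.\<close>
primrec arith :: "fm \<Rightarrow> bool" where
  "arith (s \<^bold>= t) = True"
| "arith (Box t) = False"
| "arith (A \<^bold>\<and> B) = (arith A \<and> arith B)"
| "arith (A \<^bold>\<or> B) = (arith A \<and> arith B)"
| "arith (A \<^bold>\<longrightarrow> B) = (arith A \<and> arith B)"
| "arith (Forall x A) = arith A"
| "arith (Exists x A) = arith A"

primrec substt :: "tm \<Rightarrow> nat \<Rightarrow> tm \<Rightarrow> tm" where
  "substt Zero x u = Zero"
| "substt (Var v) x u = (if v = x then u else Var v)"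
| "substt (Succ t) x u = Succ (substt t x u)"
| "substt (Plus s t) x u = Plus (substt s x u) (substt t x u)"
| "substt (Times s t) x u = Times (substt s x u) (substt t x u)"

text \<open>\<open>subst A x u\<close> is \<open>A[u/x]\<close>; it does not rename bound variables, so it is used under the
  proviso \<open>free_for u x A\<close> unless that holds automatically.\<close>
primrec subst :: "fm \<Rightarrow> nat \<Rightarrow> tm \<Rightarrow> fm" where
  "subst (s \<^bold>= t) x u = (substt s x u \<^bold>= substt t x u)"
| "subst (Box t) x u = Box (substt t x u)"
| "subst (A \<^bold>\<and> B) x u = (subst A x u \<^bold>\<and> subst B x u)"
| "subst (A \<^bold>\<or> B) x u = (subst A x u \<^bold>\<or> subst B x u)"
| "subst (A \<^bold>\<longrightarrow> B) x u = (subst A x u \<^bold>\<longrightarrow> subst B x u)"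
| "subst (Forall y A) x u = Forall y (if y = x then A else subst A x u)"
| "subst (Exists y A) x u = Exists y (if y = x then A else subst A x u)"

primrec free_for :: "tm \<Rightarrow> nat \<Rightarrow> fm \<Rightarrow> bool" where
  "free_for u x (s \<^bold>= t) = True"
| "free_for u x (Box t) = True"
| "free_for u x (A \<^bold>\<and> B) = (free_for u x A \<and> free_for u x B)"
| "free_for u x (A \<^bold>\<or> B) = (free_for u x A \<and> free_for u x B)"
| "free_for u x (A \<^bold>\<longrightarrow> B) = (free_for u x A \<and> free_for u x B)"
| "free_for u x (Forall y A) = (x \<notin> fv (Forall y A) \<or> y \<notin> fvt u \<and> free_for u x A)"
| "free_for u x (Exists y A) = (x \<notin> fv (Exists y A) \<or> y \<notin> fvt u \<and> free_for u x A)"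


section \<open>The standard model\<close>

primrec val :: "(nat \<Rightarrow> nat) \<Rightarrow> tm \<Rightarrow> nat" where
  "val e Zero = 0"
| "val e (Var v) = e v"
| "val e (Succ t) = Suc (val e t)"
| "val e (Plus s t) = val e s + val e t"
| "val e (Times s t) = val e s * val e t"

text \<open>Satisfaction is meant for \<open>arith\<close> formulas only; the clause for \<open>Box\<close> is a dummy.\<close>
primrec sat :: "(nat \<Rightarrow> nat) \<Rightarrow> fm \<Rightarrow> bool" where
  "sat e (s \<^bold>= t) = (val e s = val e t)"
| "sat e (Box t) = False"
| "sat e (A \<^bold>\<and> B) = (sat e A \<and> sat e B)"
| "sat e (A \<^bold>\<or> B) = (sat e A \<or> sat e B)"
| "sat e (A \<^bold>\<longrightarrow> B) = (sat e A \<longrightarrow> sat e B)"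
| "sat e (Forall x A) = (\<forall>n. sat (e(x := n)) A)"
| "sat e (Exists x A) = (\<exists>n. sat (e(x := n)) A)"

definition true_in_N :: "fm \<Rightarrow> bool" where
  "true_in_N A \<longleftrightarrow> (\<forall>e. sat e A)"


section \<open>Goedel numbering\<close>

text \<open>A polynomial injective pairing. Together with coding a term \<open>S\<^sup>m u\<close> (\<open>u\<close> not a successor)
  as the pair of \<open>m\<close> and the code of \<open>u\<close>, it makes the map \<open>n\<^sub>1, \<dots>, n\<^sub>k \<mapsto>\<close> Goedel number of
  \<open>A(num n\<^sub>1, \<dots>, num n\<^sub>k)\<close> the value of a term of the language of arithmetic, for every
  formula \<open>A\<close>. So substitution of numerals can be arithmetized without auxiliary formulas.\<close>

definition pr :: "nat \<Rightarrow> nat \<Rightarrow> nat" where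
  "pr a b = (a + b) * (a + b) + a"

primrec succs :: "tm \<Rightarrow> nat" where
  "succs Zero = 0"
| "succs (Var v) = 0"
| "succs (Succ t) = Suc (succs t)"
| "succs (Plus s t) = 0"
| "succs (Times s t) = 0"

primrec core_code :: "tm \<Rightarrow> nat" where
  "core_code Zero = pr 0 0"
| "core_code (Var v) = pr 1 v"
| "core_code (Succ t) = core_code t"
| "core_code (Plus s t) =
     pr 2 (pr (pr (succs s) (core_code s)) (pr (succs t) (core_code t)))"
| "core_code (Times s t) =
     pr 3 (pr (pr (succs s) (core_code s)) (pr (succs t) (core_code t)))"

definition tcode :: "tm \<Rightarrow> nat" where
  "tcode t = pr (succs t) (core_code t)"

primrec code :: "fm \<Rightarrow> nat" where
  "code (s \<^bold>= t) = pr 0 (pr (tcode s) (tcode t))"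
| "code (Box t) = pr 1 (tcode t)"
| "code (A \<^bold>\<and> B) = pr 2 (pr (code A) (code B))"
| "code (A \<^bold>\<or> B) = pr 3 (pr (code A) (code B))"
| "code (A \<^bold>\<longrightarrow> B) = pr 4 (pr (code A) (code B))"
| "code (Forall x A) = pr 5 (pr x (code A))"
| "code (Exists x A) = pr 6 (pr x (code A))"

text \<open>The same recursion inside the object language. \<open>X\<close> collects the variables bound so far;
  a variable \<open>v \<notin> X\<close> stands for an occurrence of the numeral of its value, which has
  \<open>v\<close> successors and core \<open>Zero\<close>.\<close>

definition prT :: "tm \<Rightarrow> tm \<Rightarrow> tm" where
  "prT a b = Plus (Times (Plus a b) (Plus a b)) a"

primrec succsT :: "nat set \<Rightarrow> tm \<Rightarrow> tm" where
  "succsT X Zero = num 0"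
| "succsT X (Var v) = (if v \<in> X then num 0 else Var v)"
| "succsT X (Succ t) = Succ (succsT X t)"
| "succsT X (Plus s t) = num 0"
| "succsT X (Times s t) = num 0"

primrec core_codeT :: "nat set \<Rightarrow> tm \<Rightarrow> tm" where
  "core_codeT X Zero = prT (num 0) (num 0)"
| "core_codeT X (Var v) = (if v \<in> X then prT (num 1) (num v) else prT (num 0) (num 0))"
| "core_codeT X (Succ t) = core_codeT X t"
| "core_codeT X (Plus s t) =
     prT (num 2) (prT (prT (succsT X s) (core_codeT X s)) (prT (succsT X t) (core_codeT X t)))"
| "core_codeT X (Times s t) =
     prT (num 3) (prT (prT (succsT X s) (core_codeT X s)) (prT (succsT X t) (core_codeT X t)))"

definition tcodeT :: "nat set \<Rightarrow> tm \<Rightarrow> tm" where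
  "tcodeT X t = prT (succsT X t) (core_codeT X t)"

primrec codeT :: "nat set \<Rightarrow> fm \<Rightarrow> tm" where
  "codeT X (s \<^bold>= t) = prT (num 0) (prT (tcodeT X s) (tcodeT X t))"
| "codeT X (Box t) = prT (num 1) (tcodeT X t)"
| "codeT X (A \<^bold>\<and> B) = prT (num 2) (prT (codeT X A) (codeT X B))"
| "codeT X (A \<^bold>\<or> B) = prT (num 3) (prT (codeT X A) (codeT X B))"
| "codeT X (A \<^bold>\<longrightarrow> B) = prT (num 4) (prT (codeT X A) (codeT X B))"
| "codeT X (Forall x A) = prT (num 5) (prT (num x) (codeT (insert x X) A))"
| "codeT X (Exists x A) = prT (num 6) (prT (num x) (codeT (insert x X) A))"

text \<open>\<open>\<ulcorner>A\<urcorner>\<close> is the numeral of the Goedel number if \<open>A\<close> is a sentence. If \<open>A\<close> has the free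
  variables \<open>n\<^sub>1, \<dots>, n\<^sub>k\<close>, it is a term in these variables denoting the Goedel number of the
  sentence obtained by replacing each \<open>n\<^sub>i\<close> by the numeral of its value; see
  \<open>quote_sentence\<close>, \<open>fvt_quote\<close> and \<open>val_quote_subst\<close> below.\<close>
definition quote :: "fm \<Rightarrow> tm" ("\<ulcorner>_\<urcorner>") where
  "\<ulcorner>A\<urcorner> = (if sentence A then num (code A) else codeT {} A)"

primrec Box_iter :: "nat \<Rightarrow> fm \<Rightarrow> fm" where
  "Box_iter 0 A = A"
| "Box_iter (Suc k) A = Box \<ulcorner>Box_iter k A\<urcorner>"


section \<open>Axioms and derivations\<close>

text \<open>A prefix is allowed to contain variables that are not free in the formula; otherwise the
  instances of a scheme could not be matched to the common prefix in modus ponens.\<close>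
definition closures :: "fm set \<Rightarrow> fm set" where
  "closures \<Gamma> = {foralls ns A |ns A. A \<in> \<Gamma> \<and> distinct ns \<and> fv A \<subseteq> set ns}"

text \<open>Instances of the schemes of intuitionistic predicate logic with equality, for formulas of
  the language \<open>L\<close>.\<close>
inductive_set logic_instances :: "fm set \<Rightarrow> fm set" for L where
  K: "\<lbrakk>A \<in> L; B \<in> L\<rbrakk> \<Longrightarrow> A \<^bold>\<longrightarrow> B \<^bold>\<longrightarrow> A \<in> logic_instances L"
| S: "\<lbrakk>A \<in> L; B \<in> L; C \<in> L\<rbrakk> \<Longrightarrow>
      (A \<^bold>\<longrightarrow> B \<^bold>\<longrightarrow> C) \<^bold>\<longrightarrow> (A \<^bold>\<longrightarrow> B) \<^bold>\<longrightarrow> A \<^bold>\<longrightarrow> C \<in> logic_instances L"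
| conj1: "\<lbrakk>A \<in> L; B \<in> L\<rbrakk> \<Longrightarrow> A \<^bold>\<and> B \<^bold>\<longrightarrow> A \<in> logic_instances L"
| conj2: "\<lbrakk>A \<in> L; B \<in> L\<rbrakk> \<Longrightarrow> A \<^bold>\<and> B \<^bold>\<longrightarrow> B \<in> logic_instances L"
| conjI: "\<lbrakk>A \<in> L; B \<in> L\<rbrakk> \<Longrightarrow> A \<^bold>\<longrightarrow> B \<^bold>\<longrightarrow> A \<^bold>\<and> B \<in> logic_instances L"
| disj1: "\<lbrakk>A \<in> L; B \<in> L\<rbrakk> \<Longrightarrow> A \<^bold>\<longrightarrow> A \<^bold>\<or> B \<in> logic_instances L"
| disj2: "\<lbrakk>A \<in> L; B \<in> L\<rbrakk> \<Longrightarrow> B \<^bold>\<longrightarrow> A \<^bold>\<or> B \<in> logic_instances L"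
| disjE: "\<lbrakk>A \<in> L; B \<in> L; C \<in> L\<rbrakk> \<Longrightarrow>
      (A \<^bold>\<longrightarrow> C) \<^bold>\<longrightarrow> (B \<^bold>\<longrightarrow> C) \<^bold>\<longrightarrow> A \<^bold>\<or> B \<^bold>\<longrightarrow> C \<in> logic_instances L"
| falsum: "A \<in> L \<Longrightarrow> Falsum \<^bold>\<longrightarrow> A \<in> logic_instances L"
| forallE: "\<lbrakk>A \<in> L; free_for t x A\<rbrakk> \<Longrightarrow> Forall x A \<^bold>\<longrightarrow> subst A x t \<in> logic_instances L"
| existsI: "\<lbrakk>A \<in> L; free_for t x A\<rbrakk> \<Longrightarrow> subst A x t \<^bold>\<longrightarrow> Exists x A \<in> logic_instances L"
| refl: "t \<^bold>= t \<in> logic_instances L"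
| Leibniz: "\<lbrakk>A \<in> L; free_for s x A; free_for t x A\<rbrakk> \<Longrightarrow>
      s \<^bold>= t \<^bold>\<longrightarrow> subst A x s \<^bold>\<longrightarrow> subst A x t \<in> logic_instances L"

definition generalization_axioms :: "fm set \<Rightarrow> fm set" where
  "generalization_axioms L =
     {foralls (n # ns) (A \<^bold>\<longrightarrow> B) \<^bold>\<longrightarrow> foralls ns (A \<^bold>\<longrightarrow> Forall n B) |n ns A B.
        A \<in> L \<and> B \<in> L \<and> distinct (n # ns) \<and> fv (A \<^bold>\<longrightarrow> B) \<subseteq> set (n # ns) \<and> n \<notin> fv A}
   \<union> {foralls (n # ns) (A \<^bold>\<longrightarrow> B) \<^bold>\<longrightarrow> foralls ns (Exists n A \<^bold>\<longrightarrow> B) |n ns A B.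
        A \<in> L \<and> B \<in> L \<and> distinct (n # ns) \<and> fv (A \<^bold>\<longrightarrow> B) \<subseteq> set (n # ns) \<and> n \<notin> fv B}"

definition logical_axioms :: "fm set \<Rightarrow> fm set" where
  "logical_axioms L = closures (logic_instances L) \<union> generalization_axioms L"

inductive deriv :: "fm set \<Rightarrow> fm \<Rightarrow> bool" (infix "\<turnstile>" 52) for \<Gamma> where
  ax: "A \<in> \<Gamma> \<Longrightarrow> \<Gamma> \<turnstile> A"
| mp: "\<lbrakk>distinct ns; \<Gamma> \<turnstile> foralls ns A; \<Gamma> \<turnstile> foralls ns (A \<^bold>\<longrightarrow> B)\<rbrakk> \<Longrightarrow> \<Gamma> \<turnstile> foralls ns B"

definition induction_instances :: "fm set \<Rightarrow> fm set" where
  "induction_instances L =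
     {subst A x Zero \<^bold>\<and> Forall x (A \<^bold>\<longrightarrow> subst A x (Succ (Var x))) \<^bold>\<longrightarrow> Forall x A |x A. A \<in> L}"

definition peano_instances :: "fm set" where
  "peano_instances =
     {Neg (Succ (Var 0) \<^bold>= Zero),
      Succ (Var 0) \<^bold>= Succ (Var 1) \<^bold>\<longrightarrow> Var 0 \<^bold>= Var 1,
      Plus (Var 0) Zero \<^bold>= Var 0,
      Plus (Var 0) (Succ (Var 1)) \<^bold>= Succ (Plus (Var 0) (Var 1)),
      Times (Var 0) Zero \<^bold>= Zero,
      Times (Var 0) (Succ (Var 1)) \<^bold>= Plus (Times (Var 0) (Var 1)) (Var 0)}"

definition lem_instances :: "fm set" where
  "lem_instances = {A \<^bold>\<or> Neg A |A. arith A}"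

definition PA :: "fm set" where
  "PA = closures (peano_instances \<union> induction_instances {A. arith A} \<union> lem_instances)"

text \<open>An arithmetical theory is given by its set of non-logical axioms.\<close>
definition provable_in :: "fm set \<Rightarrow> fm \<Rightarrow> bool" where
  "provable_in S A \<longleftrightarrow> logical_axioms {B. arith B} \<union> S \<turnstile> A"

inductive_set box_instances :: "fm set" where
  box_or: "Box \<ulcorner>A \<^bold>\<or> B\<urcorner> \<^bold>\<longleftrightarrow> Box \<ulcorner>A\<urcorner> \<^bold>\<or> Box \<ulcorner>B\<urcorner> \<in> box_instances"
| box_and: "Box \<ulcorner>A \<^bold>\<and> B\<urcorner> \<^bold>\<longleftrightarrow> Box \<ulcorner>A\<urcorner> \<^bold>\<and> Box \<ulcorner>B\<urcorner> \<in> box_instances"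
| box_ex: "Exists n (Box \<ulcorner>A\<urcorner>) \<^bold>\<longrightarrow> Box \<ulcorner>Exists n A\<urcorner> \<in> box_instances"
| box_all: "Box \<ulcorner>Forall n A\<urcorner> \<^bold>\<longleftrightarrow> Forall n (Box \<ulcorner>A\<urcorner>) \<in> box_instances"
| box_imp: "Box \<ulcorner>A \<^bold>\<longrightarrow> B\<urcorner> \<^bold>\<longrightarrow> Box \<ulcorner>A\<urcorner> \<^bold>\<longrightarrow> Box \<ulcorner>B\<urcorner> \<in> box_instances"
| capture: "A \<^bold>\<longrightarrow> Box \<ulcorner>A\<urcorner> \<in> box_instances"

definition main_axioms :: "fm set \<Rightarrow> fm set" where
  "main_axioms S =
     S \<union> closures (induction_instances UNIV) \<union> logical_axioms UNIV \<union> closures box_instances"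

text \<open>\<open>Ax\<close>, with free variable \<open>g\<close>, expresses that \<open>g\<close> is the Goedel number of a main axiom of
  \<open>S\<^sub>\<box>\<close>, and its true numerical instances are theorems of PA.\<close>
definition expresses_main_axioms :: "fm set \<Rightarrow> nat \<Rightarrow> fm \<Rightarrow> bool" where
  "expresses_main_axioms S g Ax \<longleftrightarrow>
     arith Ax \<and> fv Ax \<subseteq> {g} \<and>
     (\<forall>n. true_in_N (subst Ax g (num n)) \<longleftrightarrow> n \<in> code ` main_axioms S) \<and>
     (\<forall>n. true_in_N (subst Ax g (num n)) \<longrightarrow> provable_in PA (subst Ax g (num n)))"

definition S_Box :: "fm set \<Rightarrow> nat \<Rightarrow> fm \<Rightarrow> fm set" where
  "S_Box S g Ax = main_axioms S \<union> {Forall g (Ax \<^bold>\<longrightarrow> Box (Var g))}"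


section \<open>Recursively axiomatized theories\<close>

text \<open>\<open>recursive_fun k f\<close>: on lists of length \<open>k\<close>, \<open>f\<close> is a total recursive function. The values
  on lists of other lengths are irrelevant.\<close>
inductive recursive_fun :: "nat \<Rightarrow> (nat list \<Rightarrow> nat) \<Rightarrow> bool" where
  zero: "recursive_fun k (\<lambda>xs. 0)"
| succ: "recursive_fun 1 (\<lambda>xs. Suc (xs ! 0))"
| proj: "i < k \<Longrightarrow> recursive_fun k (\<lambda>xs. xs ! i)"
| comp: "\<lbrakk>recursive_fun (length gs) f; \<And>g. g \<in> set gs \<Longrightarrow> recursive_fun k g\<rbrakk> \<Longrightarrow>
    recursive_fun k (\<lambda>xs. f (map (\<lambda>g. g xs) gs))"
| prim_rec: "\<lbrakk>recursive_fun k f; recursive_fun (k + 2) h\<rbrakk> \<Longrightarrow>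
    recursive_fun (k + 1) (\<lambda>xs. rec_nat (f (tl xs)) (\<lambda>n r. h (n # r # tl xs)) (hd xs))"
| minimization: "\<lbrakk>recursive_fun (k + 1) f; \<And>xs. length xs = k \<Longrightarrow> \<exists>n. f (n # xs) = 0\<rbrakk> \<Longrightarrow>
    recursive_fun k (\<lambda>xs. LEAST n. f (n # xs) = 0)"

definition recursive_set :: "nat set \<Rightarrow> bool" where
  "recursive_set X \<longleftrightarrow> (\<exists>f. recursive_fun 1 f \<and> (\<forall>n. f [n] = (if n \<in> X then 1 else 0)))"

definition recursively_axiomatized :: "fm set \<Rightarrow> bool" where
  "recursively_axiomatized S \<longleftrightarrow>
     (\<forall>A \<in> S. arith A \<and> sentence A) \<and> recursive_set (code ` S)"

definition extends_PA :: "fm set \<Rightarrow> bool" where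
  "extends_PA S \<longleftrightarrow> (\<forall>A. provable_in PA A \<longrightarrow> provable_in S A)"

definition sound :: "fm set \<Rightarrow> bool" where
  "sound S \<longleftrightarrow> (\<forall>A \<in> S. true_in_N A)"


section \<open>Correctness of the Goedel numbering and of quotation\<close>

lemma pr_inject [simp]: "pr a b = pr c d \<longleftrightarrow> a = c \<and> b = d"
proof
  assume eq: "pr a b = pr c d"
  have aux: "pr a b < pr c d" if "a + b < c + d" for a b c d
  proof -
    have "pr a b < (a + b + 1) * (a + b + 1)" by (simp add: pr_def algebra_simps)
    also have "\<dots> \<le> (c + d) * (c + d)" using that by (intro mult_le_mono) auto
    finally show ?thesis by (simp add: pr_def)
  qed
  have "a + b = c + d" using aux[of a b c d] aux[of c d a b] eq by linarith
  then show "a = c \<and> b = d" using eq by (simp add: pr_def)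
qed simp

lemma term_code_inject: "succs s = succs t \<Longrightarrow> core_code s = core_code t \<Longrightarrow> s = t"
proof (induction s arbitrary: t)
  case Zero then show ?case by (cases t) auto
next
  case (Var v) then show ?case by (cases t) auto
next
  case (Succ s) then show ?case by (cases t) auto
next
  case (Plus s1 s2) then show ?case by (cases t) auto
next
  case (Times s1 s2) then show ?case by (cases t) auto
qed

lemma tcode_inject [simp]: "tcode s = tcode t \<longleftrightarrow> s = t"
  using term_code_inject by (auto simp: tcode_def)

theorem inj_code: "inj code"
proof
  fix A B show "code A = code B \<Longrightarrow> A = B"
    by (induction A arbitrary: B; case_tac B; simp)
qed

lemma val_num [simp]: "val e (num n) = n"
  by (induction n) auto

lemma fvt_num [simp]: "fvt (num n) = {}"
  by (induction n) auto

lemma val_prT [simp]: "val e (prT a b) = pr (val e a) (val e b)"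
  by (simp add: prT_def pr_def)

lemma fvt_prT [simp]: "fvt (prT a b) = fvt a \<union> fvt b"
  by (auto simp: prT_def)

lemma val_succsT: "fvt t \<subseteq> X \<Longrightarrow> val e (succsT X t) = succs t"
  by (induction t) auto

lemma val_core_codeT: "fvt t \<subseteq> X \<Longrightarrow> val e (core_codeT X t) = core_code t"
  by (induction t) (auto simp: val_succsT)

lemma val_codeT: "fv A \<subseteq> X \<Longrightarrow> val e (codeT X A) = code A"
proof (induction A arbitrary: X)
  case (Forall x A)
  then have "fv A \<subseteq> insert x X" by auto
  then show ?case using Forall.IH by simp
next
  case (Exists x A)
  then have "fv A \<subseteq> insert x X" by auto
  then show ?case using Exists.IH by simp
qed (auto simp: val_succsT val_core_codeT tcodeT_def tcode_def)

lemma fvt_tcodeT: "fvt (succsT X t) \<union> fvt (core_codeT X t) = fvt t - X"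
  by (induction t) auto

lemma fvt_codeT: "fvt (codeT X A) = fv A - X"
  by (induction A arbitrary: X) (auto simp: tcodeT_def fvt_tcodeT simp del: Un_iff)

lemma succs_num [simp]: "succsT X (num n) = num n" "core_codeT X (num n) = prT Zero Zero"
  by (induction n) auto

lemma val_succsT_subst:
  "x \<notin> X \<Longrightarrow> val (e(x := n)) (succsT X t) = val e (succsT X (substt t x (num n)))"
  by (induction t) auto

lemma val_core_codeT_subst:
  "x \<notin> X \<Longrightarrow> val (e(x := n)) (core_codeT X t) = val e (core_codeT X (substt t x (num n)))"
  by (induction t) (auto simp: val_succsT_subst simp del: fun_upd_apply)

lemma val_cong: "(\<And>v. v \<in> fvt t \<Longrightarrow> e v = e' v) \<Longrightarrow> val e t = val e' t"
  by (induction t) auto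

lemma val_codeT_subst:
  "x \<notin> X \<Longrightarrow> val (e(x := n)) (codeT X A) = val e (codeT X (subst A x (num n)))"
proof (induction A arbitrary: X)
  case (Forall y A)
  have "val (e(x := n)) (codeT (insert x X) A) = val e (codeT (insert x X) A)"
    by (rule val_cong) (auto simp: fvt_codeT)
  then show ?case using Forall by (auto simp del: fun_upd_apply)
next
  case (Exists y A)
  have "val (e(x := n)) (codeT (insert x X) A) = val e (codeT (insert x X) A)"
    by (rule val_cong) (auto simp: fvt_codeT)
  then show ?case using Exists by (auto simp del: fun_upd_apply)
qed (simp_all add: val_succsT_subst val_core_codeT_subst tcodeT_def)

theorem quote_sentence: "sentence A \<Longrightarrow> \<ulcorner>A\<urcorner> = num (code A)"
  by (simp add: quote_def)

theorem fvt_quote: "fvt \<ulcorner>A\<urcorner> = fv A"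
  by (simp add: quote_def fvt_codeT sentence_def)

lemma val_quote: "val e \<ulcorner>A\<urcorner> = val e (codeT {} A)"
  by (simp add: quote_def val_codeT sentence_def)

theorem val_quote_subst: "val (e(x := n)) \<ulcorner>A\<urcorner> = val e \<ulcorner>subst A x (num n)\<urcorner>"
  by (simp add: val_quote val_codeT_subst)

end

theory Submission
  imports Defs
begin

text \<open>
  Interpret \<open>S\<^sub>\<box>\<close> in a Kripke model with the natural numbers as worlds, smaller numbers being later
  stages, and with the standard model of arithmetic as the constant domain. At world \<open>0\<close> everything is
  assertible; at world \<open>n + 1\<close> the assertible sentences are those forced at world \<open>n\<close>. Capture is
  then persistence of forcing, and the jump axiom holds at \<open>n + 1\<close> because all main axioms are
  forced at \<open>n\<close>. Arithmetical formulas have their classical meaning at every world, so a false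
  arithmetical sentence \<open>A\<close> is not forced anywhere, and \<open>\<box>\<^sup>k A\<close> is not forced at world \<open>k\<close>.
\<close>

section \<open>The forcing relation and persistence\<close>

function forces :: "nat \<Rightarrow> (nat \<Rightarrow> nat) \<Rightarrow> fm \<Rightarrow> bool" where
  "forces n e (s \<^bold>= t) = (val e s = val e t)"
| "forces 0 e (Box t) = True"
| "forces (Suc n) e (Box t) = (\<exists>B. code B = val e t \<and> (\<forall>e'. forces n e' B))"
| "forces n e (A \<^bold>\<and> B) = (forces n e A \<and> forces n e B)"
| "forces n e (A \<^bold>\<or> B) = (forces n e A \<or> forces n e B)"
| "forces n e (A \<^bold>\<longrightarrow> B) = (\<forall>m. m \<le> n \<longrightarrow> forces m e A \<longrightarrow> forces m e B)"
| "forces n e (Forall x A) = (\<forall>k. forces n (e(x := k)) A)"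
| "forces n e (Exists x A) = (\<exists>k. forces n (e(x := k)) A)"
  by pat_completeness auto
termination
  \<comment> \<open>The world must come first in the measure: the box clause passes to a
    \<open>B\<close> of arbitrary size, but one world down.\<close>
  by (relation "measures [\<lambda>(n, e, A). n, \<lambda>(n, e, A). size A]") auto

definition forced :: "nat \<Rightarrow> fm \<Rightarrow> bool" where
  "forced n A \<longleftrightarrow> (\<forall>e. forces n e A)"

text \<open>An implication persists because it quantifies over all smaller worlds. A box persists to
  world \<open>0\<close> trivially; elsewhere its case is persistence of the boxed formula one world
  down, hence the outer induction on worlds.\<close>

lemma forces_Suc: "forces (Suc n) e A \<Longrightarrow> forces n e A"
proof (induction n arbitrary: e A)
  case 0
  then show ?case
    by (induction A arbitrary: e) auto
next
  case (Suc n)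
  from Suc.prems show ?case
  proof (induction A arbitrary: e)
    case (Box t)
    then show ?case using Suc.IH by auto
  qed auto
qed

lemma forces_mono: "m \<le> n \<Longrightarrow> forces n e A \<Longrightarrow> forces m e A"
  by (induction n rule: dec_induct) (auto dest: forces_Suc)

lemma forces_cong: "(\<And>v. v \<in> fv A \<Longrightarrow> e v = e' v) \<Longrightarrow> forces n e A = forces n e' A"
proof (induction A arbitrary: n e e')
  case (Eq s t)
  then have "val e s = val e' s" "val e t = val e' t" by (auto intro!: val_cong)
  then show ?case by simp
next
  case (Box t)
  then have "val e t = val e' t" by (auto intro!: val_cong)
  then show ?case by (cases n) auto
next
  case (Conj A B)
  have "forces n e A = forces n e' A" by (rule Conj.IH) (simp add: Conj.prems)
  moreover have "forces n e B = forces n e' B" by (rule Conj.IH) (simp add: Conj.prems)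
  ultimately show ?case by simp
next
  case (Disj A B)
  have "forces n e A = forces n e' A" by (rule Disj.IH) (simp add: Disj.prems)
  moreover have "forces n e B = forces n e' B" by (rule Disj.IH) (simp add: Disj.prems)
  ultimately show ?case by simp
next
  case (Imp A B)
  have "forces m e A = forces m e' A" for m by (rule Imp.IH) (simp add: Imp.prems)
  moreover have "forces m e B = forces m e' B" for m by (rule Imp.IH) (simp add: Imp.prems)
  ultimately show ?case by simp
next
  case (Forall x A)
  have "forces n (e(x := k)) A = forces n (e'(x := k)) A" for k
    by (rule Forall.IH) (simp add: Forall.prems)
  then show ?case by simp
next
  case (Exists x A)
  have "forces n (e(x := k)) A = forces n (e'(x := k)) A" for k
    by (rule Exists.IH) (simp add: Exists.prems)
  then show ?case by simp
qed

lemma forces_sentence: "sentence A \<Longrightarrow> forces n e A \<longleftrightarrow> forced n A"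
  unfolding forced_def sentence_def by (metis forces_cong empty_iff)

section \<open>Substitution\<close>

lemma val_substt: "val e (substt t x u) = val (e(x := val e u)) t"
  by (induction t) auto

lemma substt_fresh: "x \<notin> fvt t \<Longrightarrow> substt t x u = t"
  by (induction t) auto

lemma subst_fresh: "x \<notin> fv A \<Longrightarrow> subst A x u = A"
  by (induction A) (auto simp: substt_fresh)

lemma forces_subst:
  "free_for u x A \<Longrightarrow> forces n e (subst A x u) \<longleftrightarrow> forces n (e(x := val e u)) A"
proof (induction A arbitrary: n e)
  case (Box t)
  then show ?case by (cases n) (simp_all add: val_substt del: fun_upd_apply)
next
  case (Forall y A)
  show ?case
  proof (cases "x \<in> fv (Forall y A)")
    case True
    then have "x \<noteq> y" and "y \<notin> fvt u" and "free_for u x A" using Forall.prems by auto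
    moreover have "val (e(y := k)) u = val e u" for k
      using \<open>y \<notin> fvt u\<close> by (intro val_cong) auto
    ultimately show ?thesis using Forall.IH by (simp add: fun_upd_twist[of x y] del: fun_upd_apply)
  next
    case False
    \<comment> \<open>Here \<open>free_for\<close> puts no condition on \<open>u\<close> and gives
      nothing to feed the induction hypothesis, but the substitution changes nothing.\<close>
    then have "forces n (e(x := val e u)) (Forall y A) = forces n e (Forall y A)"
      by (intro forces_cong) auto
    then show ?thesis using False by (metis subst_fresh)
  qed
next
  case (Exists y A)
  show ?case
  proof (cases "x \<in> fv (Exists y A)")
    case True
    then have "x \<noteq> y" and "y \<notin> fvt u" and "free_for u x A" using Exists.prems by auto
    moreover have "val (e(y := k)) u = val e u" for k
      using \<open>y \<notin> fvt u\<close> by (intro val_cong) auto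
    ultimately show ?thesis using Exists.IH by (simp add: fun_upd_twist[of x y] del: fun_upd_apply)
  next
    case False
    then have "forces n (e(x := val e u)) (Exists y A) = forces n e (Exists y A)"
      by (intro forces_cong) auto
    then show ?thesis using False by (metis subst_fresh)
  qed
qed (auto simp: val_substt)

text \<open>A quantifier over \<open>x\<close> stops the substitution, and any other binds a
  variable foreign to \<open>u\<close>. Applied to numerals and to
  \<open>Succ (Var x)\<close>.\<close>

lemma free_for_self: "fvt u \<subseteq> {x} \<Longrightarrow> free_for u x A"
  by (induction A) auto

lemma fvt_substt_num: "fvt (substt t x (num k)) = fvt t - {x}"
  by (induction t) auto

lemma fv_subst_num: "fv (subst A x (num k)) = fv A - {x}"
  by (induction A) (auto simp: fvt_substt_num)

section \<open>Arithmetical formulas, prefixes and quotation\<close>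

lemma finite_fvt: "finite (fvt t)"
  by (induction t) auto

lemma finite_fv: "finite (fv A)"
  by (induction A) (auto simp: finite_fvt)

text \<open>Worlds matter only through boxes: without them, all worlds seen by an implication agree.
  Hence classical axioms of \<open>S\<close> can hold in an intuitionistic model.\<close>

lemma forces_arith: "arith A \<Longrightarrow> forces n e A \<longleftrightarrow> sat e A"
  by (induction A arbitrary: n e) auto

text \<open>Ranging over all assignments already acts as universal closure, so modus ponens under a
  prefix becomes plain modus ponens.\<close>

lemma forced_foralls [simp]: "forced n (foralls ns A) \<longleftrightarrow> forced n A"
proof (induction ns)
  case (Cons x ns)
  have "forced n (Forall x B) \<longleftrightarrow> forced n B" for B
    unfolding forced_def forces.simps by (metis fun_upd_triv)
  then show ?case using Cons by simp
qed simp

text \<open>For a sentence, injectivity of \<open>code\<close> leaves one candidate in the box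
  clause. Otherwise, replacing a free variable by the numeral of its value affects neither side and
  lowers the number of free variables.\<close>

lemma forces_Box_quote: "forces (Suc n) e (Box \<ulcorner>A\<urcorner>) \<longleftrightarrow> forces n e A"
proof (induction "card (fv A)" arbitrary: A)
  case 0
  then have "sentence A" by (simp add: sentence_def finite_fv)
  then show ?case
    by (simp add: quote_sentence inj_eq[OF inj_code] forces_sentence flip: forced_def)
next
  case (Suc c)
  then obtain x where x: "x \<in> fv A" by (metis card.empty ex_in_conv nat.distinct(1))
  let ?A = "subst A x (num (e x))"
  have "c = card (fv ?A)" using Suc.hyps(2) x by (simp add: fv_subst_num finite_fv)
  then have "forces (Suc n) e (Box \<ulcorner>?A\<urcorner>) = forces n e ?A" by (rule Suc.hyps(1))
  moreover have "val e \<ulcorner>A\<urcorner> = val e \<ulcorner>?A\<urcorner>" using val_quote_subst[of e x "e x"] by simp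
  moreover have "forces n e ?A = forces n e A" by (simp add: forces_subst free_for_self)
  ultimately show ?case by simp
qed

section \<open>Logical axioms\<close>

text \<open>Persistence enters in \<open>K\<close> and \<open>conjI\<close>: their first premise
  must still hold at the later stage where the second is assumed.\<close>

lemma forced_logic_instances:
  assumes "A \<in> logic_instances L" shows "forced n A"
  using assms
proof cases
  case K
  then show ?thesis using forces_mono by (auto simp: forced_def)
next
  case S
  show ?thesis
    unfolding S(1) forced_def forces.simps by (blast intro: le_trans)
next
  case conjI
  then show ?thesis using forces_mono by (auto simp: forced_def)
next
  case disjE
  then show ?thesis by (simp add: forced_def)
next
  case (Leibniz B s x t)
  then show ?thesis by (auto simp: forced_def forces_subst)
qed (auto simp: forced_def forces_subst)

lemma forced_closures: "B \<in> closures \<Gamma> \<Longrightarrow> (\<And>A. A \<in> \<Gamma> \<Longrightarrow> forced n A) \<Longrightarrow> forced n B"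
  by (auto simp: closures_def)

text \<open>A sentence forced under one assignment is forced under all, so the implication reduces
  to \<open>forced\<close> at each world.\<close>

lemma forced_ImpI:
  assumes "sentence A" "sentence B" "\<And>m. forced m A \<Longrightarrow> forced m B"
  shows "forced n (A \<^bold>\<longrightarrow> B)"
  unfolding forced_def using assms by (simp add: forces_sentence)

lemma fv_foralls: "fv (foralls ns A) = fv A - set ns"
  by (induction ns) auto

lemma forced_generalization_axioms:
  assumes "A \<in> generalization_axioms L" shows "forced n A"
proof -
  have forced_all: "forced m (B \<^bold>\<longrightarrow> Forall x C)" if "forced m (B \<^bold>\<longrightarrow> C)" "x \<notin> fv B" for m x B C
  proof -
    have "forces i (e(x := k)) B = forces i e B" for i e k
      using that(2) by (intro forces_cong) auto
    then show ?thesis using that(1) by (simp add: forced_def)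
  qed
  have forced_ex: "forced m (Exists x B \<^bold>\<longrightarrow> C)" if "forced m (B \<^bold>\<longrightarrow> C)" "x \<notin> fv C" for m x B C
  proof -
    have "forces i (e(x := k)) C = forces i e C" for i e k
      using that(2) by (intro forces_cong) auto
    then show ?thesis using that(1) unfolding forced_def forces.simps by blast
  qed
  \<comment> \<open>Both sides are closed, so \<open>forced_ImpI\<close> applies; the prefixes then
    drop out, leaving \<open>forced_all\<close> or \<open>forced_ex\<close>.\<close>
  have prefix: "forced n (foralls (x # ns) B \<^bold>\<longrightarrow> foralls ns C)"
    if "fv B \<subseteq> set (x # ns)" "fv C \<subseteq> set ns" "\<And>m. forced m B \<Longrightarrow> forced m C" for x ns B C
  proof (rule forced_ImpI)
    show "sentence (foralls (x # ns) B)" "sentence (foralls ns C)"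
      using that(1,2) by (auto simp: sentence_def fv_foralls)
    show "forced m (foralls ns C)" if "forced m (foralls (x # ns) B)" for m
      using that \<open>\<And>m. forced m B \<Longrightarrow> forced m C\<close> by (simp only: forced_foralls)
  qed
  from assms consider
      (all) x ns B C where "A = foralls (x # ns) (B \<^bold>\<longrightarrow> C) \<^bold>\<longrightarrow> foralls ns (B \<^bold>\<longrightarrow> Forall x C)"
        "fv (B \<^bold>\<longrightarrow> C) \<subseteq> set (x # ns)" "x \<notin> fv B"
    | (ex) x ns B C where "A = foralls (x # ns) (B \<^bold>\<longrightarrow> C) \<^bold>\<longrightarrow> foralls ns (Exists x B \<^bold>\<longrightarrow> C)"
        "fv (B \<^bold>\<longrightarrow> C) \<subseteq> set (x # ns)" "x \<notin> fv C"
    unfolding generalization_axioms_def by blast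
  then show ?thesis
  proof cases
    case all
    show ?thesis unfolding all(1)
      by (rule prefix) (use all(2,3) in \<open>auto intro: forced_all\<close>)
  next
    case ex
    show ?thesis unfolding ex(1)
      by (rule prefix) (use ex(2,3) in \<open>auto intro: forced_ex\<close>)
  qed
qed

lemma forced_logical_axioms: "A \<in> logical_axioms L \<Longrightarrow> forced n A"
  by (auto simp: logical_axioms_def forced_generalization_axioms
      elim!: forced_closures forced_logic_instances)

section \<open>Induction, box and jump axioms\<close>

lemma forced_induction_instances:
  assumes "A \<in> induction_instances L" shows "forced n A"
proof -
  obtain x B where
    A: "A = subst B x Zero \<^bold>\<and> Forall x (B \<^bold>\<longrightarrow> subst B x (Succ (Var x))) \<^bold>\<longrightarrow> Forall x B"
    using assms by (auto simp: induction_instances_def)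
  \<comment> \<open>The domain is the standard numbers at every world, so ordinary induction on
    \<open>k\<close> works, using the step implication at \<open>m\<close> itself.\<close>
  have "forces m (e(x := k)) B"
    if "forces m e (subst B x Zero)" "forces m e (Forall x (B \<^bold>\<longrightarrow> subst B x (Succ (Var x))))"
    for m e k
    using that by (induction k) (auto simp: forces_subst free_for_self)
  then show ?thesis by (simp add: A forced_def)
qed

lemma forced_box_instances:
  assumes "A \<in> box_instances" shows "forced n A"
proof -
  have "forces m e A" for m e
    using assms
  proof cases
    case (capture B)
    have "forces i e B \<Longrightarrow> forces i e (Box \<ulcorner>B\<urcorner>)" for i
      by (cases i) (simp_all add: forces_Box_quote forces_Suc del: forces.simps(3))
    then show ?thesis using capture by simp
  next
    case (box_imp B C)
    have "forces j e (Box \<ulcorner>C\<urcorner>)"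
      if boxes: "forces i e (Box \<ulcorner>B \<^bold>\<longrightarrow> C\<urcorner>)" "j \<le> i" "forces j e (Box \<ulcorner>B\<urcorner>)" for i j
    \<comment> \<open>At \<open>j = 0\<close> every box holds. Otherwise \<open>i\<close> is a
      successor too, and the implication forced at \<open>i - 1\<close> is applied at
      \<open>j - 1\<close>.\<close>
    proof (cases j)
      case (Suc j')
      then obtain i' where "i = Suc i'" using boxes(2) by (cases i) auto
      then show ?thesis
        using boxes Suc by (auto simp add: forces_Box_quote simp del: forces.simps(3))
    qed simp
    then show ?thesis using box_imp by simp
  next
    case (box_or B C)
    have "forces i e (Box \<ulcorner>B \<^bold>\<or> C\<urcorner>) = forces i e (Box \<ulcorner>B\<urcorner> \<^bold>\<or> Box \<ulcorner>C\<urcorner>)" for i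
      by (cases i) (simp_all add: forces_Box_quote del: forces.simps(3))
    then show ?thesis using box_or by simp
  next
    case (box_and B C)
    have "forces i e (Box \<ulcorner>B \<^bold>\<and> C\<urcorner>) = forces i e (Box \<ulcorner>B\<urcorner> \<^bold>\<and> Box \<ulcorner>C\<urcorner>)" for i
      by (cases i) (simp_all add: forces_Box_quote del: forces.simps(3))
    then show ?thesis using box_and by simp
  next
    case (box_ex x B)
    have "forces i e (Box \<ulcorner>Exists x B\<urcorner>) = forces i e (Exists x (Box \<ulcorner>B\<urcorner>))" for i
      by (cases i) (simp_all add: forces_Box_quote del: forces.simps(3))
    then show ?thesis using box_ex by simp
  next
    case (box_all x B)
    have "forces i e (Box \<ulcorner>Forall x B\<urcorner>) = forces i e (Forall x (Box \<ulcorner>B\<urcorner>))" for i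
      by (cases i) (simp_all add: forces_Box_quote del: forces.simps(3))
    then show ?thesis using box_all by simp
  qed
  then show ?thesis by (simp add: forced_def)
qed

lemma forced_main_axioms:
  assumes "recursively_axiomatized S" "sound S" "A \<in> main_axioms S"
  shows "forced n A"
proof -
  have "forced n B" if "B \<in> S" for B
    using assms(1,2) that
    by (auto simp: recursively_axiomatized_def sound_def true_in_N_def forced_def forces_arith)
  then show ?thesis
    using assms(3)
    by (auto simp: main_axioms_def forced_logical_axioms
        elim!: forced_closures forced_induction_instances forced_box_instances)
qed

text \<open>The specification of \<open>Ax\<close> concerns numerical instances, so the value
  \<open>k\<close> of \<open>g\<close> is replaced by its numeral. The instance is an arithmetical
  sentence, forced only if true.\<close>

lemma forced_jump_axiom:
  assumes "recursively_axiomatized S" "sound S" "expresses_main_axioms S g Ax"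
  shows "forced n (Forall g (Ax \<^bold>\<longrightarrow> Box (Var g)))"
proof -
  have Ax: "arith Ax" "fv Ax \<subseteq> {g}"
    "\<And>k. true_in_N (subst Ax g (num k)) \<longleftrightarrow> k \<in> code ` main_axioms S"
    using assms(3) by (auto simp: expresses_main_axioms_def)
  have "forces m (e(g := k)) (Box (Var g))" if "forces m (e(g := k)) Ax" for m e k
  proof -
    have "arith (subst B x t) = arith B" for B x t by (induction B) auto
    moreover have "sentence (subst Ax g (num k))"
      using Ax(2) by (auto simp: sentence_def fv_subst_num)
    moreover have "forces m e (subst Ax g (num k))"
      using that by (simp add: forces_subst free_for_self)
    ultimately have "arith (subst Ax g (num k))" "forced m (subst Ax g (num k))"
      using Ax(1) by (simp_all add: forces_sentence)
    then have "true_in_N (subst Ax g (num k))"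
      by (simp add: true_in_N_def forced_def forces_arith)
    then have "k \<in> code ` main_axioms S" using Ax(3) by simp
    \<comment> \<open>World \<open>0\<close> is trivial; at \<open>m > 0\<close> the axiom with code
      \<open>k\<close> is forced at \<open>m - 1\<close>.\<close>
    then show ?thesis
      using forced_main_axioms[OF assms(1,2)] by (cases m) (auto simp: forced_def)
  qed
  then show ?thesis by (simp add: forced_def)
qed

section \<open>Derivations and conclusion\<close>

lemma forced_deriv:
  assumes "\<Gamma> \<turnstile> A" "\<And>B. B \<in> \<Gamma> \<Longrightarrow> forced n B"
  shows "forced n A"
  using assms(1)
proof induction
  case (ax A)
  then show ?case by (rule assms(2))
next
  case (mp ns A B)
  then show ?case by (auto simp: forced_def[of _ "_ \<^bold>\<longrightarrow> _"]) (auto simp: forced_def)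
qed

lemma forced_S_Box:
  assumes "recursively_axiomatized S" "sound S" "expresses_main_axioms S g Ax" "S_Box S g Ax \<turnstile> A"
  shows "forced n A"
  using assms(4) forced_main_axioms[OF assms(1,2)] forced_jump_axiom[OF assms(1-3)]
  by (intro forced_deriv[OF assms(4)]) (auto simp: S_Box_def)

text \<open>Each box uses up one world.\<close>

lemma forced_Box_iter: "forced k (Box_iter k A) \<longleftrightarrow> forced 0 A"
  by (induction k) (simp_all add: forced_def forces_Box_quote del: forces.simps(3))

theorem theorem3p2:
  fixes S :: "fm set" and g :: nat and Ax A :: fm
  assumes "recursively_axiomatized S"
    and "extends_PA S"
    and "expresses_main_axioms S g Ax"
    and "sound S"
    and "arith A" and "sentence A" and "\<not> true_in_N A"
  shows "\<not> (S_Box S g Ax \<turnstile> A) \<and> (\<forall>k\<ge>1. \<not> (S_Box S g Ax \<turnstile> Box_iter k A))"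
proof -
  have "\<not> forced 0 A"
    using assms(5,7) by (simp add: forced_def true_in_N_def forces_arith)
  \<comment> \<open>Theorems are forced at all worlds: world \<open>0\<close> excludes
    \<open>A\<close>, and world \<open>k\<close> its \<open>k\<close>-fold box.\<close>
  then show ?thesis
    using forced_S_Box[OF assms(1,4,3)] forced_Box_iter by blast
qed

end
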